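(* There is a Markov shift $(\Omega=\mathbb{N}^{\mathbb{Z}},m,S=\text{shift})$ such that for each $t\in\mathbb{R}_+$ there is a finitary function $g=g_t:\mathbb{N}^{\mathbb{Z}}\to\mathbb{R}_+$ such that $\mathfrak{e}(g,S)=t$ $m$-a.s.
   Context: $\mathbb{N}=\{1,2,3,\dots\}$, $\mathbb{R}_+=[0,\infty)$. Markov shift. $S:\mathbb{N}^{\mathbb{Z}}\to\mathbb{N}^{\mathbb{Z}}$ is the (left) shift and $m$ is the shift-invariant probability determined by a stochastic matrix $p:\mathbb{N}\times\mathbb{N}\to[0,1]$ and a stationary probability vector $\rho$ (i.e. $\sum_s\rho_s p_{s,t}=\rho_t$) through $m([s_0,\dots,s_n]_k)=\rho_{s_0}p_{s_0,s_1}\cdots p_{s_{n-1},s_n}$, where $[s_0,\dots,s_n]_k:=\{x\in\mathbb{N}^{\mathbb{Z}}:x_{k+j}=s_j\ \forall\,0\le j\le n\}$. Finitary. A measurable function $f:\mathbb{N}^{\mathbb{Z}}\to\mathbb{R}$ is finitary if there is a measurable $N:\mathbb{N}^{\mathbb{Z}}\to\mathbb{N}\cup\{\infty\}$ such that for $m$-a.e. $\omega$, $N(\omega)<\infty$ and $f$ is constant, equal to $f(\omega)$, on the cylinder $\{x\in\mathbb{N}^{\mathbb{Z}}: x_i=\omega_i\ \forall\,-N(\omega)\le i\le N(\omega)\}$. Extravagance. For a sequence $(x_n)_{n\ge1}$ in $[0,\infty)$, not identically $0$, set $\mathbbm{e}((x_n)):=\limsup_{n\to\infty}\frac{x_{n+1}}{\sum_{k=1}^n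 x_k}\in[0,\infty]$; for the zero sequence set $\mathbbm{e}(\overline 0):=0$. For a probability preserving transformation $S$ of $(\Omega,m)$ and a measurable $g:\Omega\to[0,\infty)$, $\mathfrak{e}(g,S)(\omega):=\mathbbm{e}((g(S^n\omega):n\ge0))$. *)

theory Defs
  imports "HOL-Probability.Probability"
begin

text \<open>
  The alphabet is \<open>{1, 2, 3, \<dots>}\<close>, so points of the sequence space are the functions
  \<open>int \<Rightarrow> nat\<close> that never take the value 0.
\<close>

definition seq_space :: "(int \<Rightarrow> nat) measure" where
  "seq_space = PiM UNIV (\<lambda>_. count_space {1..})"

definition left_shift :: "(int \<Rightarrow> nat) \<Rightarrow> (int \<Rightarrow> nat)" where
  "left_shift x = (\<lambda>i. x (i + 1))"

text \<open>The cylinder \<open>[s 0, \<dots>, s n]\<close> at position \<open>k\<close>; only \<open>s 0, \<dots>, s n\<close> matter.\<close>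

definition cylinder :: "(nat \<Rightarrow> nat) \<Rightarrow> nat \<Rightarrow> int \<Rightarrow> (int \<Rightarrow> nat) set" where
  "cylinder s n k = {x \<in> space seq_space. \<forall>j\<le>n. x (k + int j) = s j}"

definition stochastic_matrix :: "(nat \<Rightarrow> nat \<Rightarrow> real) \<Rightarrow> bool" where
  "stochastic_matrix p \<longleftrightarrow>
     (\<forall>s\<ge>1. (\<forall>t\<ge>1. 0 \<le> p s t \<and> p s t \<le> 1) \<and> (p s has_sum 1) {1..})"

definition stationary_probability :: "(nat \<Rightarrow> nat \<Rightarrow> real) \<Rightarrow> (nat \<Rightarrow> real) \<Rightarrow> bool" where
  "stationary_probability p \<rho> \<longleftrightarrow>
     (\<forall>s\<ge>1. 0 \<le> \<rho> s) \<and> (\<rho> has_sum 1) {1..} \<and>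
     (\<forall>t\<ge>1. ((\<lambda>s. \<rho> s * p s t) has_sum \<rho> t) {1..})"

definition measure_preserving_map :: "'a measure \<Rightarrow> ('a \<Rightarrow> 'a) \<Rightarrow> bool" where
  "measure_preserving_map M T \<longleftrightarrow> T \<in> measurable M M \<and> distr M M T = M"

definition markov_shift ::
    "(nat \<Rightarrow> nat \<Rightarrow> real) \<Rightarrow> (nat \<Rightarrow> real) \<Rightarrow> (int \<Rightarrow> nat) measure \<Rightarrow> bool" where
  "markov_shift p \<rho> m \<longleftrightarrow>
     stochastic_matrix p \<and> stationary_probability p \<rho> \<and>
     prob_space m \<and> sets m = sets seq_space \<and> measure_preserving_map m left_shift \<and>
     (\<forall>s n k. (\<forall>j\<le>n. 1 \<le> s j) \<longrightarrow>
        measure m (cylinder s n k) = \<rho> (s 0) * (\<Prod>j<n. p (s j) (s (Suc j))))"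

text \<open>The radius \<open>N\<close> takes values in \<open>{1, 2, \<dots>} \<union> {\<infinity>}\<close>, which is \<open>{1..}\<close> in \<^typ>\<open>enat\<close>.\<close>

definition finitary :: "(int \<Rightarrow> nat) measure \<Rightarrow> ((int \<Rightarrow> nat) \<Rightarrow> real) \<Rightarrow> bool" where
  "finitary m f \<longleftrightarrow>
     f \<in> borel_measurable m \<and>
     (\<exists>N :: (int \<Rightarrow> nat) \<Rightarrow> enat. N \<in> measurable m (count_space {1..}) \<and>
        (AE \<omega> in m. \<exists>n. N \<omega> = enat n \<and>
           (\<forall>x\<in>space m. (\<forall>i\<in>{- int n..int n}. x i = \<omega> i) \<longrightarrow> f x = f \<omega>)))"

text \<open>
  Sequences are indexed from 1; the value at 0 is ignored. If the sequence is nonnegative and not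
  identically zero, the denominator vanishes for at most finitely many \<open>n\<close>, so the convention
  \<open>a / 0 = 0\<close> does not influence the limit superior.
\<close>

definition seq_extravagance :: "(nat \<Rightarrow> real) \<Rightarrow> ereal" where
  "seq_extravagance x =
     (if \<forall>n\<ge>1. x n = 0 then 0
      else limsup (\<lambda>n. ereal (x (n + 1) / (\<Sum>k=1..n. x k))))"

text \<open>The orbit sequence starts with \<open>g \<omega>\<close>, which is its entry of index 1.\<close>

definition extravagance :: "('a \<Rightarrow> real) \<Rightarrow> ('a \<Rightarrow> 'a) \<Rightarrow> 'a \<Rightarrow> ereal" where
  "extravagance g T \<omega> = seq_extravagance (\<lambda>n. g ((T ^^ (n - 1)) \<omega>))"

end

theory Submission
  imports Defs
begin

text \<open>
  The shift is the Bernoulli shift with symbol weights \<open>2\<^sup>-\<^sup>s\<close>. For \<open>t > 0\<close> put \<open>l = 1 + t\<close> and choose \<open>K\<close>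
  so large that the probability \<open>q\<close> of a symbol \<open>\<le> K\<close> satisfies \<open>l q > 1\<close>. The value \<open>g \<omega>\<close> depends on
  the number \<open>a\<close> of consecutive symbols \<open>\<le> K\<close> ending at time 0: it is \<open>1\<close> for \<open>a = 0\<close> and
  \<open>t l\<^sup>a\<^sup>-\<^sup>1\<close> otherwise. Along a run the values therefore add up to \<open>l\<^sup>a\<close>, and each value is exactly \<open>t\<close> times
  the sum over the run so far; hence the extravagance is at most \<open>t\<close>. It equals \<open>t\<close> as soon as
  infinitely often a run dominates everything before it by an arbitrarily large factor. Since \<open>l q > 1\<close>, run sums
  have infinite mean, and in a suitable window of length of order \<open>q\<^sup>-\<^sup>r\<close> such a record has probability
  bounded below uniformly in \<open>r\<close>; over disjoint windows these events are independent.
\<close>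

section \<open>Deterministic bounds for the ratios along a run\<close>

definition ramp :: "real \<Rightarrow> nat \<Rightarrow> real" where
  "ramp t j = (case j of 0 \<Rightarrow> 1 | Suc i \<Rightarrow> t * (1 + t) ^ i)"

lemma ramp_simps [simp]: "ramp t 0 = 1" "ramp t (Suc i) = t * (1 + t) ^ i"
  by (simp_all add: ramp_def)

lemma ramp_pos: "0 < t \<Longrightarrow> 0 < ramp t j"
  by (cases j) auto

lemma ramp_ge_min: "0 < t \<Longrightarrow> min 1 t \<le> ramp t j"
  by (cases j) (auto simp: min_le_iff_disj mult_le_cancel_left1)

lemma ramp_le_power: "0 < t \<Longrightarrow> ramp t j \<le> (1 + t) ^ j"
  by (cases j) (auto intro: mult_right_mono)

text \<open>The value at \<open>Suc i\<close> is the increment of the powers of \<open>1 + t\<close>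
  from \<open>i\<close> to \<open>Suc i\<close>, so the sum telescopes. This is why the next value
  of a run is exactly \<open>t\<close> times the run so far.\<close>

lemma sum_ramp: "(\<Sum>i\<le>j. ramp t i) = (1 + t) ^ j"
  by (induction j) (auto simp: algebra_simps)

text \<open>After a reset at \<open>s\<close> the current run lies entirely inside the orbit segment
  that is summed, so \<open>(1 + t) ^ a n\<close> is at most the sum up to \<open>n\<close>, and
  continuing the run adds \<open>t\<close> times that power. A value at a reset is 1 and is
  negligible against a sum of linear growth. The reset is taken at a time \<open>s\<close> of at
  least 1 because the recursion leaves \<open>a 0\<close> free.\<close>

lemma limsup_ramp_ratio_le:
  assumes t: "0 < t"
    and step: "\<And>n. a (Suc n) = (if b (Suc n) then Suc (a n) else 0)"
    and s: "1 \<le> s" "\<not> b s"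
  shows "limsup (\<lambda>n. ereal (ramp t (a n) / (\<Sum>k<n. ramp t (a k)))) \<le> ereal t"
proof -
  have block: "(1 + t) ^ a n \<le> (\<Sum>k\<le>n. ramp t (a k))" if "s \<le> n" for n
    using that
  proof (induction n rule: dec_induct)
    case base
    obtain m where "s = Suc m" using s by (cases s) auto
    then have "a s = 0" using step s by simp
    then show ?case
      using member_le_sum[of s "{..s}" "\<lambda>k. ramp t (a k)"] ramp_pos[OF t, THEN less_imp_le] by simp
  next
    case (step n)
    then show ?case
      using assms(2)[of n] sum_nonneg[of "{..n}" "\<lambda>k. ramp t (a k)"] ramp_pos[OF t, THEN less_imp_le]
      by (auto simp: algebra_simps)
  qed
  have lower: "real n * min 1 t \<le> (\<Sum>k<n. ramp t (a k))" for n
    using sum_bounded_below[of "{..<n}" "min 1 t" "\<lambda>k. ramp t (a k)"] ramp_ge_min[OF t] by simp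
  \<comment> \<open>Past this threshold the linear lower bound makes \<open>t\<close> times the sum
    at least 1, which is the value at a reset.\<close>
  have "\<forall>\<^sub>F n in sequentially. 1 / (t * min 1 t) \<le> real n"
    using filterlim_real_sequentially by (simp add: filterlim_at_top)
  moreover have "\<forall>\<^sub>F n in sequentially. Suc s \<le> n"
    by (rule eventually_ge_at_top)
  ultimately have "\<forall>\<^sub>F n in sequentially. ramp t (a n) / (\<Sum>k<n. ramp t (a k)) \<le> t"
  proof eventually_elim
    case (elim n)
    then obtain m where m: "n = Suc m" "s \<le> m" by (cases n) auto
    have mt: "0 < min 1 t" using t by simp
    have pos: "0 < (\<Sum>k<n. ramp t (a k))"
      using m ramp_pos[OF t] by (intro sum_pos) auto
    have "ramp t (a n) \<le> t * (\<Sum>k<n. ramp t (a k))"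
    proof (cases "b n")
      case True
      then show ?thesis
        using step[of m] block[OF m(2)] m t by (simp add: lessThan_Suc_atMost mult_left_mono)
    next
      case False
      have "1 \<le> t * (real n * min 1 t)"
        using elim(1) mt t by (simp add: field_simps)
      also have "\<dots> \<le> t * (\<Sum>k<n. ramp t (a k))"
        using lower t by (intro mult_left_mono) auto
      finally show ?thesis using False step[of m] m by simp
    qed
    then show ?case using pos by (simp add: pos_divide_le_eq)
  qed
  then show ?thesis
    by (intro Limsup_bounded) (auto elim: eventually_mono)
qed

section \<open>Run lengths and record windows\<close>

text \<open>Runs are cut off at index 0, so that the value at \<open>n\<close> depends on finitely
  many bits only.\<close>

primrec run_length :: "(nat \<Rightarrow> bool) \<Rightarrow> nat \<Rightarrow> nat" where
  "run_length c 0 = (if c 0 then 1 else 0)"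
| "run_length c (Suc n) = (if c (Suc n) then Suc (run_length c n) else 0)"

text \<open>The reset at 0 makes the run lengths in a window independent of all bits before the window.\<close>

definition record_window :: "real \<Rightarrow> real \<Rightarrow> nat \<Rightarrow> nat \<Rightarrow> nat \<Rightarrow> (nat \<Rightarrow> bool) \<Rightarrow> bool" where
  "record_window l C m r e c \<longleftrightarrow> \<not> c 0 \<and>
     (\<exists>N\<in>{1..m}. \<not> c N \<and> (\<forall>j\<in>{1..Suc (r + e)}. c (N + j)) \<and>
        (\<Sum>n<N. l ^ run_length c n) \<le> C * l ^ r)"

text \<open>The sum before the last index of the record run splits into three parts: before
  \<open>u\<close> (at most \<open>(1 + t) ^ r\<close>), the window before \<open>N\<close> (at most
  \<open>C * (1 + t) ^ r\<close>), and the run itself (exactly \<open>(1 + t) ^ (r + e)\<close>).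
  The next value is \<open>t * (1 + t) ^ (r + e)\<close>, so \<open>e\<close> measures how far the
  run dominates its past.\<close>

lemma ramp_ratio_ge_if_record_window:
  assumes t: "0 < t" and C: "0 \<le> C"
    and step: "\<And>n. a (Suc n) = (if b (Suc n) then Suc (a n) else 0)"
    and u: "1 \<le> u" "a 0 \<le> u" "real u * (1 + t) ^ (2 * u) \<le> (1 + t) ^ r"
    and rec: "record_window (1 + t) C m r e (\<lambda>i. b (u + i))"
  obtains n where "u \<le> n"
    "t / (1 + (C + 1) / (1 + t) ^ e) \<le> ramp t (a n) / (\<Sum>k<n. ramp t (a k))"
proof -
  let ?c = "\<lambda>i. b (u + i)"
  from rec obtain N where N: "\<not> b u" "\<not> b (u + N)" "\<And>j. 1 \<le> j \<Longrightarrow> j \<le> Suc (r + e) \<Longrightarrow> b (u + (N + j))"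
    "(\<Sum>n<N. (1 + t) ^ run_length ?c n) \<le> C * (1 + t) ^ r"
    by (auto simp: record_window_def)
  have reset: "a i = 0" if "1 \<le> i" "\<not> b i" for i
    using step[of "i - 1"] that by simp
  \<comment> \<open>The false bit at \<open>u\<close> resets \<open>a\<close>, and from there on
    both sides obey the same recursion.\<close>
  have run: "a (u + i) = run_length ?c i" for i
    by (induction i) (use reset u N(1) step in auto)
  have up: "a (u + N + j) = j" if "j \<le> Suc (r + e)" for j
    using that
  proof (induction j)
    case 0
    then show ?case using reset[of "u + N"] u N by simp
  next
    case (Suc j)
    then show ?case using step[of "u + N + j"] N(3)[of "Suc j"] by (simp add: add.assoc)
  qed
  define n where "n = u + N + Suc (r + e)"
  define S where "S = (\<Sum>k<n. ramp t (a k))"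
  have a_le: "a k \<le> a 0 + k" for k
    by (induction k) (use step in auto)
  \<comment> \<open>Before \<open>u\<close> it is only used that \<open>a\<close> grows by at most
    one per step, whence \<open>a k\<close> is at most \<open>a 0 + k\<close> and so at most
    \<open>2 * u\<close>; the choice of \<open>r\<close> absorbs this crude bound.\<close>
  have S1: "(\<Sum>k<u. ramp t (a k)) \<le> (1 + t) ^ r"
  proof -
    have "(\<Sum>k<u. ramp t (a k)) \<le> (\<Sum>k<u. (1 + t) ^ (2 * u))"
    proof (intro sum_mono)
      fix k assume "k \<in> {..<u}"
      then have "a k \<le> 2 * u" using a_le[of k] u by simp
      then have "(1 + t) ^ a k \<le> (1 + t) ^ (2 * u)" using t by (intro power_increasing) auto
      then show "ramp t (a k) \<le> (1 + t) ^ (2 * u)" using ramp_le_power[OF t, of "a k"] by simp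
    qed
    then show ?thesis using u by simp
  qed
  have S2: "(\<Sum>i<N. ramp t (a (u + i))) \<le> C * (1 + t) ^ r"
    by (rule order.trans[OF sum_mono N(4)]) (simp add: run ramp_le_power[OF t])
  have S3: "(\<Sum>j<Suc (r + e). ramp t (a (u + N + j))) = (1 + t) ^ (r + e)"
    using up sum_ramp[of t "r + e"] by (simp add: lessThan_Suc_atMost)
  have split: "(\<Sum>k<x + y. f k) = (\<Sum>k<x. f k) + (\<Sum>k<y. f (x + k))" for x y and f :: "nat \<Rightarrow> real"
    by (induction y) auto
  have S_eq: "S = (\<Sum>k<u. ramp t (a k)) + (\<Sum>i<N. ramp t (a (u + i))) + (1 + t) ^ (r + e)"
    using split[of "\<lambda>k. ramp t (a k)" "u + N" "Suc (r + e)"] split[of "\<lambda>k. ramp t (a k)" u N] S3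
    unfolding S_def n_def by (simp only: add.assoc)
  have S_le: "S \<le> (1 + t) ^ (r + e) * (1 + (C + 1) / (1 + t) ^ e)"
  proof -
    have "(1 + t) ^ (r + e) * (1 + (C + 1) / (1 + t) ^ e) = (1 + t) ^ (r + e) + (C + 1) * (1 + t) ^ r"
      using t by (simp add: field_simps power_add)
    then show ?thesis using S1 S2 unfolding S_eq by (simp add: algebra_simps)
  qed
  have "0 < S"
    unfolding S_def n_def by (intro sum_pos) (auto simp: ramp_pos[OF t])
  have pos: "0 < 1 + (C + 1) / (1 + t) ^ e"
    using C t by (intro add_pos_nonneg divide_nonneg_nonneg) auto
  have "ramp t (a n) = t * (1 + t) ^ (r + e)"
    unfolding n_def using up[of "Suc (r + e)"] by simp
  then have "t * S \<le> ramp t (a n) * (1 + (C + 1) / (1 + t) ^ e)"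
    using mult_left_mono[OF S_le, of t] t by (simp add: mult.assoc)
  then have "t / (1 + (C + 1) / (1 + t) ^ e) \<le> ramp t (a n) / S"
    using pos \<open>0 < S\<close> by (simp add: field_simps)
  then show ?thesis
    using that[of n] by (simp add: S_def n_def)
qed

lemma run_length_cong: "(\<And>i. i \<le> n \<Longrightarrow> c i = c' i) \<Longrightarrow> run_length c n = run_length c' n"
  by (induction n) auto

lemma le_run_length_imp:
  "j \<le> run_length c n \<Longrightarrow> j \<le> Suc n \<and> (\<forall>i\<in>{Suc n - j..<Suc n}. c i)"
proof (induction n arbitrary: j)
  case 0
  then show ?case by (auto split: if_splits)
next
  case (Suc n)
  show ?case
  proof (cases j)
    case (Suc j')
    then show ?thesis
      using Suc.IH[of j'] Suc.prems by (auto split: if_splits simp: less_Suc_eq)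
  qed auto
qed

lemma run_length_after_reset:
  "\<not> c N \<Longrightarrow> (\<forall>i\<in>{1..j}. c (N + i)) \<Longrightarrow> run_length c (N + j) = j"
proof (induction j)
  case 0
  then show ?case by (cases N) auto
next
  case (Suc j)
  then have "c (N + Suc j)" by (metis atLeastAtMost_iff le_add1 order_refl plus_1_eq_Suc)
  then show ?case using Suc by simp
qed

section \<open>Independent bits and events determined by finitely many of them\<close>

text \<open>For finite \<open>J\<close> the restriction of the bits to \<open>J\<close> lives in a
  discrete product space, so this condition alone yields measurability, and independence over
  disjoint index sets.\<close>

definition depends_on :: "nat set \<Rightarrow> ((nat \<Rightarrow> bool) \<Rightarrow> bool) \<Rightarrow> bool" where
  "depends_on J P \<longleftrightarrow> (\<forall>c c'. (\<forall>i\<in>J. c i = c' i) \<longrightarrow> P c = P c')"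

lemma depends_on_restrict: "depends_on J P \<Longrightarrow> P (restrict c J) = P c"
  by (auto simp: depends_on_def)

lemma PiM_bool:
  "finite J \<Longrightarrow> PiM J (\<lambda>_. count_space UNIV :: bool measure) = count_space (J \<rightarrow>\<^sub>E UNIV)" for J :: "nat set"
  by (rule count_space_PiM_finite) auto

text \<open>Working with abstract bits lets the same estimates serve forward coordinates, backward
  coordinates and sequences that start at a later index.\<close>

locale bernoulli_sequence = prob_space M for M :: "'a measure" +
  fixes b :: "nat \<Rightarrow> 'a \<Rightarrow> bool" and q :: real
  assumes indep: "indep_vars (\<lambda>_. count_space UNIV) b UNIV"
    and prob_b: "\<And>n. prob {\<omega> \<in> space M. b n \<omega>} = q"
begin

lemma measurable_b [measurable]: "b n \<in> measurable M (count_space UNIV)"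
  using indep by (auto simp: indep_vars_def)

lemma sets_depends_on:
  assumes "finite J" "depends_on J P"
  shows "{\<omega> \<in> space M. P (\<lambda>i. b i \<omega>)} \<in> events"
proof -
  have "(\<lambda>\<omega>. restrict (\<lambda>i. b i \<omega>) J) \<in> measurable M (PiM J (\<lambda>_. count_space UNIV))"
    by measurable
  then have "(\<lambda>\<omega>. P (restrict (\<lambda>i. b i \<omega>) J)) \<in> measurable M (count_space UNIV)"
    by (rule measurable_compose) (simp add: PiM_bool assms)
  then show ?thesis
    by (simp add: depends_on_restrict[OF assms(2)] pred_def)
qed

lemma prob_depends_on_disjoint:
  assumes J: "finite J" "depends_on J P" and K: "finite K" "depends_on K Q" and JK: "J \<inter> K = {}"
  shows "\<P>(\<omega> in M. P (\<lambda>i. b i \<omega>) \<and> Q (\<lambda>i. b i \<omega>)) =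
    \<P>(\<omega> in M. P (\<lambda>i. b i \<omega>)) * \<P>(\<omega> in M. Q (\<lambda>i. b i \<omega>))"
proof -
  have "indep_var (count_space UNIV) (P \<circ> (\<lambda>\<omega>. restrict (\<lambda>i. b i \<omega>) J))
    (count_space UNIV) (Q \<circ> (\<lambda>\<omega>. restrict (\<lambda>i. b i \<omega>) K))"
    by (rule indep_var_compose[OF indep_var_restrict[OF indep JK]]) (simp_all add: PiM_bool J K)
  then have "indep_var (count_space UNIV) (\<lambda>\<omega>. P (\<lambda>i. b i \<omega>)) (count_space UNIV) (\<lambda>\<omega>. Q (\<lambda>i. b i \<omega>))"
    by (simp add: comp_def depends_on_restrict[OF J(2)] depends_on_restrict[OF K(2)])
  from prob_indep_random_variable[OF this, of "{True}" "{True}"] show ?thesis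
    by simp
qed

lemma prob_all:
  assumes "finite J"
  shows "\<P>(\<omega> in M. \<forall>j\<in>J. b j \<omega>) = q ^ card J"
proof (cases "J = {}")
  case True
  then show ?thesis by (simp add: prob_space)
next
  case False
  have "prob (\<Inter>j\<in>J. b j -` {True} \<inter> space M) = (\<Prod>j\<in>J. prob (b j -` {True} \<inter> space M))"
    using False assms by (intro indep_varsD[OF indep]) auto
  moreover have "b j -` {True} \<inter> space M = {\<omega> \<in> space M. b j \<omega>}" for j
    by auto
  moreover have "(\<Inter>j\<in>J. {\<omega> \<in> space M. b j \<omega>}) = {\<omega> \<in> space M. \<forall>j\<in>J. b j \<omega>}"
    using False by auto
  ultimately show ?thesis by (simp add: prob_b)
qed

lemma prob_not: "\<P>(\<omega> in M. \<not> b n \<omega>) = 1 - q"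
proof -
  have "{\<omega> \<in> space M. b n \<omega>} \<in> events" by measurable
  from prob_compl[OF this] have "prob (space M - {\<omega> \<in> space M. b n \<omega>}) = 1 - q"
    by (simp add: prob_b)
  moreover have "space M - {\<omega> \<in> space M. b n \<omega>} = {\<omega> \<in> space M. \<not> b n \<omega>}" by auto
  ultimately show ?thesis by simp
qed

lemma q_bounds: "0 \<le> q" "q \<le> 1"
  using measure_nonneg[of M "{\<omega> \<in> space M. b 0 \<omega>}"] prob_le_1[of "{\<omega> \<in> space M. b 0 \<omega>}"]
  by (simp_all add: prob_b)

text \<open>The first \<open>n\<close> bits are all true with probability \<open>q ^ n\<close>,
  which tends to 0.\<close>

lemma AE_ex_not:
  assumes "q < 1"
  shows "AE \<omega> in M. \<exists>n. \<not> b n \<omega>"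
proof -
  have [measurable]: "{\<omega> \<in> space M. \<forall>n. b n \<omega>} \<in> events"
    by measurable
  have "prob {\<omega> \<in> space M. \<forall>n. b n \<omega>} \<le> q ^ n" for n
  proof -
    have "prob {\<omega> \<in> space M. \<forall>n. b n \<omega>} \<le> \<P>(\<omega> in M. \<forall>j\<in>{..<n}. b j \<omega>)"
      by (rule finite_measure_mono) auto
    then show ?thesis by (simp add: prob_all)
  qed
  then have "prob {\<omega> \<in> space M. \<forall>n. b n \<omega>} \<le> 0"
    using q_bounds assms by (intro LIMSEQ_le_const[OF LIMSEQ_realpow_zero[of q]]) auto
  then have "prob {\<omega> \<in> space M. \<forall>n. b n \<omega>} = 0"
    using measure_nonneg[of M "{\<omega> \<in> space M. \<forall>n. b n \<omega>}"] by linarith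
  moreover have "{\<omega> \<in> space M. \<not> (\<exists>n. \<not> b n \<omega>)} = {\<omega> \<in> space M. \<forall>n. b n \<omega>}"
    by auto
  ultimately show ?thesis
    by (intro AE_I[where N = "{\<omega> \<in> space M. \<forall>n. b n \<omega>}"]) (auto simp: emeasure_eq_measure)
qed

abbreviation bits :: "'a \<Rightarrow> nat \<Rightarrow> bool" where
  "bits \<omega> \<equiv> \<lambda>i. b i \<omega>"

section \<open>Probability of a record in one window\<close>

lemma measurable_run_length [measurable]:
  "(\<lambda>\<omega>. run_length (bits \<omega>) n) \<in> measurable M (count_space UNIV)"
  by (induction n) simp_all

text \<open>Such a run prescribes \<open>j\<close> true bits. If \<open>j\<close> exceeds
  \<open>Suc n\<close>, it would have to start before index 0 and the event is empty.\<close>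

lemma prob_le_run_length: "\<P>(\<omega> in M. j \<le> run_length (bits \<omega>) n) \<le> q ^ j"
proof (cases "j \<le> Suc n")
  case True
  have "\<P>(\<omega> in M. j \<le> run_length (bits \<omega>) n) \<le> \<P>(\<omega> in M. \<forall>i\<in>{Suc n - j..<Suc n}. b i \<omega>)"
    by (rule finite_measure_mono) (auto dest: le_run_length_imp)
  then show ?thesis using True by (simp add: prob_all)
next
  case False
  then have "{\<omega> \<in> space M. j \<le> run_length (bits \<omega>) n} = {}"
    using le_run_length_imp by blast
  then have "\<P>(\<omega> in M. j \<le> run_length (bits \<omega>) n) = 0"
    by (simp only: measure_empty)
  then show ?thesis using q_bounds by (simp only: zero_le_power)
qed

text \<open>The expectation of \<open>\<Sum>n<m. l ^ run_length (bits \<omega>) n\<close> is of larger order than \<open>l ^ r\<close> because of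
  rare long runs, so runs longer than \<open>r\<close> are excluded separately before Markov's inequality is used.\<close>

lemma prob_sum_power_run_length_gt:
  assumes l: "1 < l * q" "1 < l" and m: "real m * q ^ r \<le> \<eta> / 2"
  shows "\<P>(\<omega> in M. l * q / (l * q - 1) * l ^ r < (\<Sum>n<m. l ^ run_length (bits \<omega>) n)) \<le> \<eta>"
proof -
  define C where "C = l * q / (l * q - 1)"
  have C: "0 < C" using l by (simp add: C_def)
  \<comment> \<open>A majorant that is linear in indicators: as long as the run length at
    \<open>n\<close> is at most \<open>r\<close>, the summand with \<open>j\<close> equal to it
    already gives the required power, and the other summands are nonnegative.\<close>
  define Z where "Z \<omega> = (\<Sum>n<m. \<Sum>j\<le>r. l ^ j * indicator {\<omega> \<in> space M. j \<le> run_length (bits \<omega>) n} \<omega>)" for \<omega>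
  have int: "integrable M (\<lambda>\<omega>. l ^ j * indicator {\<omega> \<in> space M. j \<le> run_length (bits \<omega>) n} \<omega> :: real)" for j n
    by (intro integrable_mult_right integrable_real_indicator) (auto simp: emeasure_eq_measure)
  have Z_int: "integrable M Z"
    unfolding Z_def by (intro Bochner_Integration.integrable_sum int)
  have Z_nonneg: "0 \<le> Z \<omega>" for \<omega>
    unfolding Z_def using l by (intro sum_nonneg mult_nonneg_nonneg) auto
  have "expectation Z = (\<Sum>n<m. \<Sum>j\<le>r. l ^ j * \<P>(\<omega> in M. j \<le> run_length (bits \<omega>) n))"
  proof -
    have "expectation Z = (\<Sum>n<m. \<Sum>j\<le>r. expectation (\<lambda>\<omega>. l ^ j * indicator {\<omega> \<in> space M. j \<le> run_length (bits \<omega>) n} \<omega>))"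
      unfolding Z_def
      by (subst Bochner_Integration.integral_sum, intro Bochner_Integration.integrable_sum int,
          intro sum.cong refl Bochner_Integration.integral_sum int)
    then show ?thesis by simp
  qed
  also have "\<dots> \<le> (\<Sum>n<m. \<Sum>j\<le>r. l ^ j * q ^ j)"
    using l by (intro sum_mono mult_left_mono prob_le_run_length) auto
  also have "\<dots> = real m * (\<Sum>j\<le>r. (l * q) ^ j)"
    by (simp add: power_mult_distrib)
  \<comment> \<open>Since \<open>l * q > 1\<close>, the last term controls the geometric sum up to a
    constant factor. This is the origin of \<open>C\<close>.\<close>
  also have "(\<Sum>j\<le>r. (l * q) ^ j) = ((l * q) ^ Suc r - 1) / (l * q - 1)"
    using l geometric_sum[of "l * q" "Suc r"] by (simp add: lessThan_Suc_atMost)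
  also have "\<dots> \<le> (l * q) ^ Suc r / (l * q - 1)"
    using l by (intro divide_right_mono) auto
  also have "\<dots> = C * l ^ r * q ^ r"
    by (simp add: C_def power_mult_distrib)
  finally have EZ: "expectation Z \<le> real m * (C * l ^ r * q ^ r)"
    by (simp add: mult_left_mono)
  have "\<P>(\<omega> in M. C * l ^ r \<le> Z \<omega>) \<le> expectation Z / (C * l ^ r)"
    using C l Z_nonneg Z_int by (intro integral_Markov_inequality_measure[where A = "space M"]) auto
  also have "\<dots> \<le> real m * q ^ r"
    using EZ C l by (simp add: pos_divide_le_eq mult_ac)
  finally have P1: "\<P>(\<omega> in M. C * l ^ r \<le> Z \<omega>) \<le> real m * q ^ r" .
  \<comment> \<open>A union bound excludes runs longer than \<open>r\<close>. It costs at most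
    \<open>m * q ^ r\<close>, as Markov's inequality did, that is, half of \<eta> each.\<close>
  have "prob (\<Union>n<m. {\<omega> \<in> space M. Suc r \<le> run_length (bits \<omega>) n})
      \<le> (\<Sum>n<m. \<P>(\<omega> in M. Suc r \<le> run_length (bits \<omega>) n))"
    by (rule finite_measure_subadditive_finite) auto
  also have "\<dots> \<le> (\<Sum>n<m. q ^ Suc r)"
    by (intro sum_mono prob_le_run_length)
  also have "\<dots> \<le> real m * q ^ r"
    using q_bounds by (simp add: mult_left_mono mult_left_le_one_le)
  finally have P2: "prob (\<Union>n<m. {\<omega> \<in> space M. Suc r \<le> run_length (bits \<omega>) n}) \<le> real m * q ^ r" .
  have sub: "{\<omega> \<in> space M. C * l ^ r < (\<Sum>n<m. l ^ run_length (bits \<omega>) n)}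
      \<subseteq> (\<Union>n<m. {\<omega> \<in> space M. Suc r \<le> run_length (bits \<omega>) n}) \<union> {\<omega> \<in> space M. C * l ^ r \<le> Z \<omega>}"
  proof (rule subsetI, rule UnCI)
    fix \<omega> assume "\<omega> \<in> {\<omega> \<in> space M. C * l ^ r < (\<Sum>n<m. l ^ run_length (bits \<omega>) n)}"
      and "\<omega> \<notin> {\<omega> \<in> space M. C * l ^ r \<le> Z \<omega>}"
    then have \<omega>: "\<omega> \<in> space M" "C * l ^ r < (\<Sum>n<m. l ^ run_length (bits \<omega>) n)" "\<not> C * l ^ r \<le> Z \<omega>"
      by auto
    show "\<omega> \<in> (\<Union>n<m. {\<omega> \<in> space M. Suc r \<le> run_length (bits \<omega>) n})"
    proof (rule ccontr)
      assume no: "\<not> ?thesis"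
      have "(\<Sum>n<m. l ^ run_length (bits \<omega>) n) \<le> Z \<omega>"
        unfolding Z_def
      proof (intro sum_mono)
        fix n assume "n \<in> {..<m}"
        then have le: "run_length (bits \<omega>) n \<le> r" using no \<omega>(1) by (auto simp: not_less_eq_eq)
        have "l ^ run_length (bits \<omega>) n = l ^ run_length (bits \<omega>) n *
          indicator {\<omega>' \<in> space M. run_length (bits \<omega>) n \<le> run_length (bits \<omega>') n} \<omega>"
          using \<omega>(1) by simp
        also have "\<dots> \<le> (\<Sum>j\<le>r. l ^ j * indicator {\<omega> \<in> space M. j \<le> run_length (bits \<omega>) n} \<omega>)"
          using le l by (intro member_le_sum[where f = "\<lambda>j. l ^ j * indicator {\<omega> \<in> space M. j \<le> run_length (bits \<omega>) n} \<omega>"]) auto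
        finally show "l ^ run_length (bits \<omega>) n \<le>
          (\<Sum>j\<le>r. l ^ j * indicator {\<omega> \<in> space M. j \<le> run_length (bits \<omega>) n} \<omega>)" .
      qed
      then show False using \<omega> by simp
    qed
  qed
  have meas: "{\<omega> \<in> space M. C * l ^ r \<le> Z \<omega>} \<in> events"
    using Z_int by measurable
  have "prob {\<omega> \<in> space M. C * l ^ r < (\<Sum>n<m. l ^ run_length (bits \<omega>) n)}
      \<le> prob ((\<Union>n<m. {\<omega> \<in> space M. Suc r \<le> run_length (bits \<omega>) n}) \<union> {\<omega> \<in> space M. C * l ^ r \<le> Z \<omega>})"
    using meas by (intro finite_measure_mono sub) auto
  also have "\<dots> \<le> prob (\<Union>n<m. {\<omega> \<in> space M. Suc r \<le> run_length (bits \<omega>) n}) + prob {\<omega> \<in> space M. C * l ^ r \<le> Z \<omega>}"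
    using meas by (intro measure_Un_le) auto
  also have "\<dots> \<le> \<eta>" using P1 P2 m by simp
  finally show ?thesis by (simp add: C_def)
qed

text \<open>A record at \<open>N\<close> combines a small sum before \<open>N\<close> with a run of
  \<open>Suc (r + e)\<close> true bits after a false bit at \<open>N\<close>. These two events are
  independent, and the records at different \<open>N\<close> are disjoint by the choice of
  \<open>e\<close>, so their probabilities add up. The window length, of order
  \<open>q ^ -r\<close>, cancels the factor \<open>q ^ r\<close>, which makes the bound independent
  of \<open>r\<close>.\<close>

lemma prob_record_window_ge:
  fixes l :: real
  defines "C \<equiv> l * q / (l * q - 1)"
  assumes q: "0 < q" "q < 1" and l: "1 < l * q" "1 < l"
    and e: "C < l ^ Suc e" and r: "q ^ r \<le> (1 - q) / 4"
  shows "(1 - q) / 8 * ((1 - q) / 2 * ((1 - q) * q ^ Suc e)) \<le>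
    \<P>(\<omega> in M. record_window l C (nat \<lfloor>(1 - q) / (4 * q ^ r)\<rfloor>) r e (bits \<omega>))"
proof -
  \<comment> \<open>The largest window length with \<open>m * q ^ r\<close> at most
    \<open>(1 - q) / 4\<close>. The previous estimate then applies with \<eta> equal to
    \<open>(1 - q) / 2\<close>, and rounding down loses at most a factor 2 because the quotient is
    at least 1.\<close>
  define m where "m = nat \<lfloor>(1 - q) / (4 * q ^ r)\<rfloor>"
  have C: "0 < C" using l by (simp add: C_def)
  have x: "1 \<le> (1 - q) / (4 * q ^ r)" using r q by (simp add: field_simps)
  have m_le: "real m * q ^ r \<le> (1 - q) / 2 / 2"
  proof -
    have "real m \<le> (1 - q) / (4 * q ^ r)" using x by (simp add: m_def)
    then have "real m * q ^ r \<le> (1 - q) / (4 * q ^ r) * q ^ r"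
      by (intro mult_right_mono) (use q in auto)
    also have "\<dots> = (1 - q) / 2 / 2" using q by simp
    finally show ?thesis .
  qed
  have half_floor: "y / 2 \<le> real (nat \<lfloor>y\<rfloor>)" if "1 \<le> y" for y :: real
  proof -
    have "1 \<le> \<lfloor>y\<rfloor>" using that by simp
    then have "1 \<le> real (nat \<lfloor>y\<rfloor>)" "real (nat \<lfloor>y\<rfloor>) = of_int \<lfloor>y\<rfloor>" by auto
    then show ?thesis using floor_correct[of y] by linarith
  qed
  have m_ge: "(1 - q) / 8 \<le> real m * q ^ r"
  proof -
    have "(1 - q) / (4 * q ^ r) / 2 \<le> real m"
      unfolding m_def using x by (rule half_floor)
    then have "(1 - q) / (4 * q ^ r) / 2 * q ^ r \<le> real m * q ^ r"
      by (intro mult_right_mono) (use q in auto)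
    moreover have "(1 - q) / (4 * q ^ r) / 2 * q ^ r = (1 - q) / 8" using q by simp
    ultimately show ?thesis by simp
  qed
  \<comment> \<open>\<open>D N\<close> reads the bits below \<open>N\<close> (including bit 0, as
    \<open>N\<close> is at least 1) and \<open>G N\<close> reads the bits from \<open>N\<close> on;
    this separation gives independence.\<close>
  define D where "D N c \<longleftrightarrow> \<not> c 0 \<and> (\<Sum>n<N. l ^ run_length c n) \<le> C * l ^ r" for N and c :: "nat \<Rightarrow> bool"
  define G where "G N c \<longleftrightarrow> \<not> c N \<and> (\<forall>j\<in>{Suc N..N + Suc (r + e)}. c j)" for N and c :: "nat \<Rightarrow> bool"
  have dep_D: "depends_on {..<N} (D N)" if "1 \<le> N" for N
    unfolding depends_on_def
  proof (intro allI impI)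
    fix c c' :: "nat \<Rightarrow> bool"
    assume "\<forall>i\<in>{..<N}. c i = c' i"
    then have "(\<Sum>n<N. l ^ run_length c n) = (\<Sum>n<N. l ^ run_length c' n)" "c 0 = c' 0"
      using that by (auto intro!: sum.cong arg_cong[where f = "(^) l"] run_length_cong)
    then show "D N c = D N c'" by (simp add: D_def)
  qed
  have dep_G: "depends_on {N..N + Suc (r + e)} (G N)" for N
    unfolding depends_on_def G_def by auto
  have prob_G: "\<P>(\<omega> in M. G N (bits \<omega>)) = (1 - q) * q ^ Suc (r + e)" for N
  proof -
    have "\<P>(\<omega> in M. \<not> bits \<omega> N \<and> (\<forall>j\<in>{Suc N..N + Suc (r + e)}. bits \<omega> j)) =
      \<P>(\<omega> in M. \<not> bits \<omega> N) * \<P>(\<omega> in M. \<forall>j\<in>{Suc N..N + Suc (r + e)}. bits \<omega> j)"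
      by (intro prob_depends_on_disjoint[of "{N}" "\<lambda>c. \<not> c N" "{Suc N..N + Suc (r + e)}"])
         (auto simp: depends_on_def)
    then show ?thesis using prob_all[of "{Suc N..N + Suc (r + e)}"] by (simp add: G_def prob_not)
  qed
  \<comment> \<open>The sum over the whole window bounds the sum before each \<open>N\<close>, so
    one exceptional event serves all \<open>N\<close>. It removes at most half of the probability
    \<open>1 - q\<close> that bit 0 is false.\<close>
  have prob_D: "(1 - q) / 2 \<le> \<P>(\<omega> in M. D N (bits \<omega>))" if N: "N \<in> {1..m}" for N
  proof -
    let ?Y = "{\<omega> \<in> space M. C * l ^ r < (\<Sum>n<m. l ^ run_length (bits \<omega>) n)}"
    have mono: "(\<Sum>n<N. l ^ run_length c n) \<le> (\<Sum>n<m. l ^ run_length c n)" for c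
      using N l by (intro sum_mono2) auto
    have D_sets: "{\<omega> \<in> space M. D N (bits \<omega>)} \<in> events"
      using N by (intro sets_depends_on[of "{..<N}"] dep_D) auto
    have Y_sets: "?Y \<in> events"
      by measurable
    have "1 - q = \<P>(\<omega> in M. \<not> b 0 \<omega>)" by (simp add: prob_not)
    also have "\<dots> \<le> prob ({\<omega> \<in> space M. D N (bits \<omega>)} \<union> ?Y)"
      using D_sets Y_sets mono by (intro finite_measure_mono) (fastforce simp: D_def not_less intro: order.trans)+
    also have "\<dots> \<le> \<P>(\<omega> in M. D N (bits \<omega>)) + prob ?Y"
      by (intro measure_Un_le D_sets Y_sets)
    finally have "1 - q \<le> \<P>(\<omega> in M. D N (bits \<omega>)) + prob ?Y" .
    moreover have "prob ?Y \<le> (1 - q) / 2"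
      using prob_sum_power_run_length_gt[OF l m_le] by (simp add: C_def)
    ultimately show ?thesis by argo
  qed
  define F where "F N = {\<omega> \<in> space M. D N (bits \<omega>) \<and> G N (bits \<omega>)}" for N
  have prob_F: "(1 - q) / 2 * ((1 - q) * q ^ Suc (r + e)) \<le> prob (F N)" if N: "N \<in> {1..m}" for N
  proof -
    have "prob (F N) = \<P>(\<omega> in M. D N (bits \<omega>)) * \<P>(\<omega> in M. G N (bits \<omega>))"
      unfolding F_def using N
      by (intro prob_depends_on_disjoint[OF _ dep_D _ dep_G]) auto
    then show ?thesis
      unfolding prob_G using prob_D[OF N] q by (auto intro!: mult_right_mono)
  qed
  have F_sets: "F N \<in> events" if "N \<in> {1..m}" for N
  proof -
    have "depends_on {..N + Suc (r + e)} (\<lambda>c. D N c \<and> G N c)"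
      using dep_D[of N] dep_G[of N] that unfolding depends_on_def by (metis atLeastAtMost_iff atMost_iff le_add1 lessThan_iff less_imp_le order.trans)
    then show ?thesis unfolding F_def by (intro sets_depends_on) auto
  qed
  \<comment> \<open>The first run alone makes the sum before \<open>N'\<close> exceed \<open>C * l ^ r\<close>, hence the events \<open>F N\<close> are disjoint.\<close>
  have no_overlap: "\<not> (D N' c \<and> G N' c)" if "G N c" "N < N'" for N N' c
  proof
    assume N': "D N' c \<and> G N' c"
    show False
    proof (cases "N' \<le> N + Suc (r + e)")
      case True
      then show False using that N' by (auto simp: G_def)
    next
      case False
      have "run_length c (N + Suc (r + e)) = Suc (r + e)"
        using that(1) by (intro run_length_after_reset) (auto simp: G_def)
      then have "l ^ Suc (r + e) \<le> (\<Sum>n<N'. l ^ run_length c n)"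
        using member_le_sum[of "N + Suc (r + e)" "{..<N'}" "\<lambda>n. l ^ run_length c n"] False l by simp
      also have "\<dots> \<le> C * l ^ r" using N' by (simp add: D_def)
      also have "\<dots> < l ^ Suc e * l ^ r" using e l by (intro mult_strict_right_mono) auto
      finally show False by (simp add: power_add mult_ac)
    qed
  qed
  have disj: "disjoint_family_on F {1..m}"
    unfolding disjoint_family_on_def
  proof (intro ballI impI)
    fix N N' :: nat assume "N \<noteq> N'"
    then consider "N < N'" | "N' < N" by linarith
    then show "F N \<inter> F N' = {}"
      by cases (use no_overlap in \<open>auto simp: F_def\<close>)
  qed
  have "(1 - q) / 8 * ((1 - q) / 2 * ((1 - q) * q ^ Suc e))
      \<le> real m * q ^ r * ((1 - q) / 2 * ((1 - q) * q ^ Suc e))"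
    using m_ge q by (intro mult_right_mono) auto
  also have "\<dots> = (\<Sum>N\<in>{1..m}. (1 - q) / 2 * ((1 - q) * q ^ Suc (r + e)))"
    by (simp add: power_add mult_ac)
  also have "\<dots> \<le> (\<Sum>N\<in>{1..m}. prob (F N))"
    by (intro sum_mono prob_F)
  also have "\<dots> = prob (\<Union>N\<in>{1..m}. F N)"
    using F_sets disj by (intro finite_measure_finite_Union[symmetric]) auto
  also have "(\<Union>N\<in>{1..m}. F N) = {\<omega> \<in> space M. record_window l C m r e (bits \<omega>)}"
  proof -
    have "(\<forall>j\<in>{Suc N..N + Suc (r + e)}. c j) \<longleftrightarrow> (\<forall>j\<in>{1..Suc (r + e)}. c (N + j))" for N and c :: "nat \<Rightarrow> bool"
    proof
      assume *: "\<forall>j\<in>{1..Suc (r + e)}. c (N + j)"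
      show "\<forall>j\<in>{Suc N..N + Suc (r + e)}. c j"
      proof
        fix j assume "j \<in> {Suc N..N + Suc (r + e)}"
        then have "j - N \<in> {1..Suc (r + e)}" "N + (j - N) = j" by auto
        then show "c j" using * by metis
      qed
    qed auto
    then show ?thesis by (auto simp: F_def D_def G_def record_window_def)
  qed
  finally show ?thesis by (simp add: m_def)
qed

section \<open>Infinitely many records\<close>

lemma bernoulli_sequence_shift: "bernoulli_sequence M (\<lambda>i. b (u + i)) q"
proof unfold_locales
  have "indep_vars (\<lambda>j. PiM {u + j} (\<lambda>_. count_space UNIV)) (\<lambda>j \<omega>. restrict (bits \<omega>) {u + j}) (UNIV :: nat set)"
    by (rule indep_vars_restrict[OF indep]) (auto simp: disjoint_family_on_def)
  from indep_vars_compose2[OF this, of "\<lambda>j c. c (u + j)" "\<lambda>_. count_space UNIV"]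
  show "indep_vars (\<lambda>_. count_space UNIV) (\<lambda>i. b (u + i)) UNIV"
    by (simp add: PiM_bool)
qed (rule prob_b)

text \<open>Disjoint windows give independent events, so their limit superior has probability 0 or 1
  by Borel's zero-one law. It is the decreasing limit of tail unions of probability at least
  \<kappa>, which leaves only 1.\<close>

lemma AE_infinite_windows:
  assumes W: "\<And>k. finite (W k)" "disjoint_family W"
    and P: "\<And>k. depends_on (W k) (P k)"
    and \<kappa>: "0 < \<kappa>" "\<And>k :: nat. \<kappa> \<le> \<P>(\<omega> in M. P k (bits \<omega>))"
  shows "AE \<omega> in M. infinite {k. P k (bits \<omega>)}"
proof -
  define F where "F k = {\<omega> \<in> space M. P k (bits \<omega>)}" for k
  have F_sets: "F k \<in> events" for k
    unfolding F_def by (intro sets_depends_on[OF W(1) P])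
  have "indep_vars (\<lambda>k. PiM (W k) (\<lambda>_. count_space UNIV)) (\<lambda>k \<omega>. restrict (bits \<omega>) (W k)) UNIV"
    by (rule indep_vars_restrict[OF indep]) (use W in auto)
  then have "indep_events (\<lambda>k. {\<omega> \<in> space M. P k (restrict (bits \<omega>) (W k))}) UNIV"
    by (rule indep_eventsI_indep_vars) (auto simp: PiM_bool W)
  then have ind: "indep_events F UNIV"
    by (simp add: F_def[abs_def] depends_on_restrict[OF P])
  define A where "A n = (\<Union>k\<in>{n..}. F k)" for n
  have A_sets: "range A \<subseteq> events"
    unfolding A_def using F_sets by auto
  have "(\<lambda>n. prob (A n)) \<longlonglongrightarrow> prob (\<Inter>n. A n)"
    by (intro finite_Lim_measure_decseq A_sets) (force simp: decseq_def A_def)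
  moreover have "\<kappa> \<le> prob (A n)" for n
    using \<kappa>(2)[of n] finite_measure_mono[of "F n" "A n"] A_sets by (force simp: A_def F_def)
  ultimately have "\<kappa> \<le> prob (\<Inter>n. A n)"
    by (intro LIMSEQ_le_const) auto
  then have "prob (\<Inter>n. A n) = 1"
    using borel_0_1_law[OF ind] \<kappa>(1) by (auto simp: A_def)
  then have "AE \<omega> in M. \<omega> \<in> (\<Inter>n. A n)"
    using A_sets by (subst (asm) prob_eq_1) auto
  then show ?thesis
    by eventually_elim (auto simp: A_def F_def infinite_nat_iff_unbounded_le)
qed

text \<open>The windows are built one after another: once the start \<open>u\<close> is fixed,
  \<open>r\<close> is taken so large that everything before \<open>u\<close> is negligible against
  \<open>l ^ r\<close>, and so that the bound for a record in one window applies. That bound does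
  not depend on \<open>r\<close>, hence is uniform over the windows.\<close>

lemma AE_infinite_record_windows:
  fixes l :: real
  defines "C \<equiv> l * q / (l * q - 1)"
  assumes q: "0 < q" "q < 1" and l: "1 < l * q" "1 < l" and e: "C < l ^ Suc e"
  obtains u r m :: "nat \<Rightarrow> nat" where "\<And>k. k < u k"
    "\<And>k. real (u k) * l ^ (2 * u k) \<le> l ^ r k"
    "AE \<omega> in M. infinite {k. record_window l C (m k) (r k) e (\<lambda>i. b (u k + i) \<omega>)}"
proof -
  have "\<exists>r. real u * l ^ (2 * u) \<le> l ^ r \<and> q ^ r \<le> (1 - q) / 4" for u :: nat
  proof -
    have "filterlim (\<lambda>r. l ^ r) at_top sequentially"
      using l by real_asymp
    then have "\<forall>\<^sub>F r in sequentially. real u * l ^ (2 * u) \<le> l ^ r"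
      by (simp add: filterlim_at_top)
    moreover have "(\<lambda>r. q ^ r) \<longlonglongrightarrow> 0"
      using q by (intro LIMSEQ_realpow_zero) auto
    then have "\<forall>\<^sub>F r in sequentially. q ^ r < (1 - q) / 4"
      using q by (intro order_tendstoD) auto
    ultimately have "\<forall>\<^sub>F r in sequentially. real u * l ^ (2 * u) \<le> l ^ r \<and> q ^ r \<le> (1 - q) / 4"
      by eventually_elim auto
    then show ?thesis by (auto simp: eventually_sequentially)
  qed
  then obtain r where r: "\<And>u :: nat. real u * l ^ (2 * u) \<le> l ^ r u" "\<And>u. q ^ r u \<le> (1 - q) / 4"
    by metis
  define m where "m u = nat \<lfloor>(1 - q) / (4 * q ^ r u)\<rfloor>" for u
  \<comment> \<open>A record at \<open>N\<close> in \<open>{1..m v}\<close> reads bits up to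
    \<open>v + m v + Suc (r v + e)\<close>; the next window starts one index later.\<close>
  define next_start where "next_start v = v + m v + Suc (Suc (r v + e))" for v
  define u where "u k = (next_start ^^ k) 1" for k
  have u_Suc: "u (Suc k) = u k + m (u k) + Suc (Suc (r (u k) + e))" for k
    by (simp add: u_def next_start_def)
  have "k < u k" for k
    by (induction k) (simp add: u_def, simp add: u_Suc)
  moreover have "AE \<omega> in M. infinite {k. record_window l C (m (u k)) (r (u k)) e (\<lambda>i. b (u k + i) \<omega>)}"
  proof (rule AE_infinite_windows[where W = "\<lambda>k. {..<u (Suc k)} - {..<u k}"
        and P = "\<lambda>k c. record_window l C (m (u k)) (r (u k)) e (\<lambda>i. c (u k + i))"])
    show "disjoint_family (\<lambda>k. {..<u (Suc k)} - {..<u k})"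
      by (rule disjoint_family_Suc[of "\<lambda>k. {..<u k}"]) (auto simp: u_Suc)
    show "0 < (1 - q) / 8 * ((1 - q) / 2 * ((1 - q) * q ^ Suc e))"
      using q by simp
  next
    fix k
    interpret shifted: bernoulli_sequence M "\<lambda>i. b (u k + i)" q
      by (rule bernoulli_sequence_shift)
    show "(1 - q) / 8 * ((1 - q) / 2 * ((1 - q) * q ^ Suc e)) \<le>
        \<P>(\<omega> in M. record_window l C (m (u k)) (r (u k)) e (\<lambda>i. b (u k + i) \<omega>))"
      unfolding m_def C_def using q l e r(2) by (intro shifted.prob_record_window_ge) (auto simp: C_def)
    show "depends_on ({..<u (Suc k)} - {..<u k})
        (\<lambda>c. record_window l C (m (u k)) (r (u k)) e (\<lambda>i. c (u k + i)))"
      unfolding depends_on_def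
    proof (intro allI impI)
      fix c c' :: "nat \<Rightarrow> bool" assume "\<forall>i\<in>{..<u (Suc k)} - {..<u k}. c i = c' i"
      then have eq: "c (u k + i) = c' (u k + i)" if "i < m (u k) + Suc (Suc (r (u k) + e))" for i
        using that by (simp add: u_Suc)
      have run: "run_length (\<lambda>i. c (u k + i)) n = run_length (\<lambda>i. c' (u k + i)) n" if "n < m (u k)" for n
        using that eq by (intro run_length_cong) simp
      show "record_window l C (m (u k)) (r (u k)) e (\<lambda>i. c (u k + i)) =
          record_window l C (m (u k)) (r (u k)) e (\<lambda>i. c' (u k + i))"
        unfolding record_window_def
        by (intro arg_cong2[where f = "(\<and>)"] bex_cong ball_cong arg_cong[where f = Not]
            arg_cong[where f = "\<lambda>x. x \<le> C * l ^ r (u k)"] sum.cong refl)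
           (auto simp: eq eq[of 0, simplified] run)
    qed
  qed simp
  ultimately show ?thesis
    using that[of u "\<lambda>k. r (u k)" "\<lambda>k. m (u k)"] r(1) by blast
qed

end

section \<open>The Bernoulli shift as a Markov shift\<close>

text \<open>The geometric law starts at 0, so \<open>Suc\<close> moves it to the alphabet. The
  target \<open>count_space {1..}\<close> makes the product have the same measurable sets as
  \<open>seq_space\<close>.\<close>

definition symbol_measure :: "nat measure" where
  "symbol_measure = distr (measure_pmf (geometric_pmf (1 / 2))) (count_space {1..}) Suc"

definition iid_measure :: "(int \<Rightarrow> nat) measure" where
  "iid_measure = PiM UNIV (\<lambda>_. symbol_measure)"

lemma measurable_Suc_symbols: "Suc \<in> measurable (measure_pmf p) (count_space {1..})"
  by (auto simp: measurable_def)

lemma sets_symbol_measure [simp, measurable_cong]: "sets symbol_measure = sets (count_space {1..})"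
  and space_symbol_measure [simp]: "space symbol_measure = {1..}"
  by (simp_all add: symbol_measure_def)

interpretation symbol: prob_space symbol_measure
  unfolding symbol_measure_def
  by (rule measure_pmf.prob_space_distr[OF measurable_Suc_symbols])

interpretation iid: product_prob_space "\<lambda>_. symbol_measure" "UNIV :: int set"
  by unfold_locales

lemma measure_symbol: "1 \<le> s \<Longrightarrow> measure symbol_measure {s} = (1 / 2) ^ s"
proof -
  assume "1 \<le> s"
  then obtain n where n: "s = Suc n" by (cases s) auto
  then have "Suc -` {s} = {n}" by auto
  then show ?thesis
    using n unfolding symbol_measure_def
    by (subst measure_distr) (auto simp: measurable_Suc_symbols measure_pmf_single)
qed

lemma measure_symbol_le: "measure symbol_measure {1..K} = 1 - (1 / 2) ^ K"
proof -
  have "Suc -` {1..K} = {..<K}" by auto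
  then have "measure symbol_measure {1..K} = measure (measure_pmf (geometric_pmf (1 / 2))) {..<K}"
    unfolding symbol_measure_def by (subst measure_distr) (auto simp: measurable_Suc_symbols)
  also have "\<dots> = (\<Sum>n<K. (1 / 2) ^ n * (1 / 2))"
    by (subst measure_measure_pmf_finite) auto
  also have "\<dots> = 1 - (1 / 2) ^ K"
    by (induction K) auto
  finally show ?thesis .
qed

lemma sets_iid_measure: "sets iid_measure = sets seq_space"
  unfolding iid_measure_def seq_space_def by (intro sets_PiM_cong) auto

lemma space_iid_measure: "space iid_measure = UNIV \<rightarrow>\<^sub>E {1..}"
  by (simp add: iid_measure_def space_PiM)

lemma prob_space_iid_measure: "prob_space iid_measure"
  unfolding iid_measure_def by unfold_locales

lemma measurable_coordinate [measurable]: "(\<lambda>\<omega>. \<omega> i) \<in> measurable iid_measure symbol_measure"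
  unfolding iid_measure_def by measurable

lemma pred_coordinate_le [measurable]: "Measurable.pred iid_measure (\<lambda>\<omega>. \<omega> i \<le> K)"
  by (rule measurable_compose[OF measurable_coordinate]) simp

text \<open>Distinct coordinates of an i.i.d. family are again i.i.d. This gives both shift
  invariance and the independence of selected coordinates.\<close>

lemma distr_iid_measure_reindex:
  assumes "inj f"
  shows "distr iid_measure (PiM UNIV (\<lambda>_. symbol_measure)) (\<lambda>\<omega> n. \<omega> (f n)) = PiM UNIV (\<lambda>_. symbol_measure)"
  using distr_PiM_reindex[of UNIV "\<lambda>_. symbol_measure" f UNIV] assms symbol.prob_space_axioms
  by (simp add: iid_measure_def restrict_UNIV)

lemma measure_preserving_left_shift: "measure_preserving_map iid_measure left_shift"
proof -
  have "left_shift = (\<lambda>\<omega> i. \<omega> (i + 1))" by (auto simp: left_shift_def)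
  moreover have "distr iid_measure iid_measure (\<lambda>\<omega> i. \<omega> (i + 1)) = iid_measure"
    using distr_iid_measure_reindex[of "\<lambda>i :: int. i + 1"] by (simp add: iid_measure_def inj_def)
  moreover have "(\<lambda>\<omega> i. \<omega> (i + 1)) \<in> measurable iid_measure iid_measure"
    unfolding iid_measure_def by (rule measurable_PiM_single') (auto simp: space_PiM)
  ultimately show ?thesis by (simp add: measure_preserving_map_def)
qed

text \<open>An i.i.d. sequence is a Markov chain whose matrix has every row equal to the symbol law,
  and this law is stationary.\<close>

lemma markov_shift_iid_measure:
  "markov_shift (\<lambda>s t. (1 / 2) ^ t) (\<lambda>s. (1 / 2) ^ s) iid_measure"
  unfolding markov_shift_def
proof (intro conjI allI impI)
  have sum1: "((\<lambda>s. (1 / 2) ^ s :: real) has_sum 1) {1..}"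
    using has_sum_geometric_from_1[of "1 / 2 :: real"] by simp
  show "stochastic_matrix (\<lambda>s t. (1 / 2) ^ t)"
    using sum1 by (auto simp: stochastic_matrix_def power_le_one)
  show "stationary_probability (\<lambda>s t. (1 / 2) ^ t) (\<lambda>s. (1 / 2) ^ s)"
    using sum1 has_sum_cmult_left[OF sum1] by (fastforce simp: stationary_probability_def)
  show "prob_space iid_measure" by (rule prob_space_iid_measure)
  show "sets iid_measure = sets seq_space" by (rule sets_iid_measure)
  show "measure_preserving_map iid_measure left_shift" by (rule measure_preserving_left_shift)
  fix s :: "nat \<Rightarrow> nat" and n and k :: int
  assume s: "\<forall>j\<le>n. 1 \<le> s j"
  \<comment> \<open>The cylinder is a product set over the positions in \<open>J\<close>;
    \<open>s'\<close> is the word indexed by absolute position.\<close>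
  define J where "J = (\<lambda>j. k + int j) ` {..n}"
  define s' where "s' i = s (nat (i - k))" for i
  have "cylinder s n k = prod_emb UNIV (\<lambda>_. symbol_measure) J (PiE J (\<lambda>i. {s' i}))"
    unfolding cylinder_def prod_emb_def J_def s'_def seq_space_def
    by (auto simp: space_PiM PiE_iff restrict_def extensional_def)
  then have "measure iid_measure (cylinder s n k) = (\<Prod>i\<in>J. measure symbol_measure {s' i})"
    unfolding iid_measure_def using s
    by (simp only:) (intro iid.measure_PiM_emb; auto simp: J_def s'_def)
  also have "\<dots> = (\<Prod>j\<le>n. (1 / 2) ^ s j)"
    unfolding J_def using s by (subst prod.reindex) (auto simp: s'_def measure_symbol inj_on_def intro!: prod.cong)
  also have "\<dots> = (1 / 2) ^ s 0 * (\<Prod>j<n. (1 / 2) ^ s (Suc j))"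
    by (subst prod.atMost_shift) simp
  finally show "measure iid_measure (cylinder s n k) = (1 / 2) ^ s 0 * (\<Prod>j<n. (1 / 2) ^ s (Suc j))" .
qed

lemma bernoulli_sequence_iid_measure:
  assumes "inj f"
  shows "bernoulli_sequence iid_measure (\<lambda>n \<omega>. \<omega> (f n) \<le> K) (1 - (1 / 2) ^ K)"
proof -
  interpret prob_space iid_measure by (rule prob_space_iid_measure)
  have distr_i: "distr iid_measure symbol_measure (\<lambda>\<omega>. \<omega> i) = symbol_measure" for i
    unfolding iid_measure_def by (rule iid.PiM_component) simp
  have "indep_vars (\<lambda>_. symbol_measure) (\<lambda>n \<omega>. \<omega> (f n)) UNIV"
    by (subst indep_vars_iff_distr_eq_PiM) (simp_all add: distr_i restrict_UNIV distr_iid_measure_reindex[OF assms])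
  then have "indep_vars (\<lambda>_. count_space UNIV) (\<lambda>n \<omega>. \<omega> (f n) \<le> K) UNIV"
    by (rule indep_vars_compose2[where Y = "\<lambda>_ s. s \<le> K"]) simp
  moreover have "prob {\<omega> \<in> space iid_measure. \<omega> (f n) \<le> K} = 1 - (1 / 2) ^ K" for n
  proof -
    have "prob {\<omega> \<in> space iid_measure. \<omega> (f n) \<le> K} =
        measure (distr iid_measure symbol_measure (\<lambda>\<omega>. \<omega> (f n))) {1..K}"
      by (subst measure_distr) (auto simp: space_iid_measure PiE_iff intro!: arg_cong[where f = prob])
    then show ?thesis using measure_symbol_le[of K] by (simp add: distr_i)
  qed
  ultimately show ?thesis by unfold_locales
qed

section \<open>The finitary functions and their extravagance\<close>

text \<open>The length of the maximal run of symbols at most \<open>K\<close> that ends at time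
  \<open>n\<close>. If this run has no beginning, \<open>LEAST\<close> has no witness; for
  \<open>n = 0\<close> and positive \<open>K\<close> this is a null event.\<close>

definition age :: "nat \<Rightarrow> (int \<Rightarrow> nat) \<Rightarrow> int \<Rightarrow> nat" where
  "age K \<omega> n = (LEAST j. \<not> \<omega> (n - int j) \<le> K)"

text \<open>One symbol above \<open>K\<close> at a time up to 0 provides a witness for
  \<open>LEAST\<close> at every later time, and a step of time shifts the witnesses by one.\<close>

lemma age_Suc:
  assumes "\<exists>j. \<not> \<omega> (- int j) \<le> K"
  shows "age K \<omega> (int (Suc n)) = (if \<omega> (int (Suc n)) \<le> K then Suc (age K \<omega> (int n)) else 0)"
proof -
  obtain j where "\<not> \<omega> (- int j) \<le> K" using assms by auto
  then have "\<not> \<omega> (int (Suc n) - int (j + Suc n)) \<le> K" by simp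
  then show ?thesis
    unfolding age_def by (auto simp: Least_Suc[where P = "\<lambda>j. \<not> \<omega> (int (Suc n) - int j) \<le> K"] simp del: of_nat_Suc intro!: Least_eq_0)
       (simp add: Least_Suc)
qed

lemma measurable_age [measurable]: "(\<lambda>\<omega>. age K \<omega> n) \<in> measurable iid_measure (count_space UNIV)"
  unfolding age_def by measurable

lemma AE_iid_ex_gt_neg:
  assumes "0 < K" shows "AE \<omega> in iid_measure. \<exists>j. \<not> \<omega> (- int j) \<le> K"
proof -
  interpret bernoulli_sequence iid_measure "\<lambda>n \<omega>. \<omega> (- int n) \<le> K" "1 - (1 / 2) ^ K"
    by (rule bernoulli_sequence_iid_measure) (simp add: inj_def)
  show ?thesis by (rule AE_ex_not) simp
qed

text \<open>The age at 0 is decided by the coordinates from the last symbol above \<open>K\<close>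
  up to time 0. The radius is one larger than the age because it must be at least 1. A general
  \<open>h\<close> also covers the zero function.\<close>

lemma finitary_age:
  assumes "0 < K"
  shows "finitary iid_measure (\<lambda>\<omega>. h (age K \<omega> 0) :: real)"
proof -
  define N where "N \<omega> = (if \<exists>j. \<not> \<omega> (- int j) \<le> K then enat (Suc (age K \<omega> 0)) else \<infinity>)" for \<omega>
  have "(\<lambda>\<omega>. h (age K \<omega> 0)) \<in> borel_measurable iid_measure"
    by (rule measurable_compose[OF measurable_age]) simp
  moreover have "N \<in> measurable iid_measure (count_space {1..})"
  proof -
    have "N \<in> measurable iid_measure (count_space UNIV)"
      unfolding N_def by measurable
    then show ?thesis
      by (rule measurable_count_space_extend[rotated 2, where A = "{1..}"]) (auto simp: N_def one_enat_def)
  qed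
  moreover have "AE \<omega> in iid_measure. \<exists>n. N \<omega> = enat n \<and>
      (\<forall>x\<in>space iid_measure. (\<forall>i\<in>{- int n..int n}. x i = \<omega> i) \<longrightarrow> h (age K x 0) = h (age K \<omega> 0))"
    using AE_iid_ex_gt_neg[OF assms]
  proof eventually_elim
    case (elim \<omega>)
    show ?case
    proof (intro exI[of _ "Suc (age K \<omega> 0)"] conjI ballI impI)
      show "N \<omega> = enat (Suc (age K \<omega> 0))" using elim by (simp add: N_def)
      fix x :: "int \<Rightarrow> nat"
      assume x: "\<forall>i\<in>{- int (Suc (age K \<omega> 0))..int (Suc (age K \<omega> 0))}. x i = \<omega> i"
      have "age K x 0 = age K \<omega> 0"
        unfolding age_def[of K x]
      proof (rule Least_equality)
        have "\<not> \<omega> (0 - int (age K \<omega> 0)) \<le> K"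
          unfolding age_def using elim by (intro LeastI_ex[of "\<lambda>j. \<not> \<omega> (0 - int j) \<le> K"]) simp
        then show "\<not> x (0 - int (age K \<omega> 0)) \<le> K" using x by simp
        fix j assume j: "\<not> x (0 - int j) \<le> K"
        show "age K \<omega> 0 \<le> j"
        proof (rule ccontr)
          assume less: "\<not> age K \<omega> 0 \<le> j"
          then have "\<not> \<omega> (0 - int j) \<le> K" using x j by simp
          then have "age K \<omega> 0 \<le> j" unfolding age_def by (rule Least_le)
          then show False using less by simp
        qed
      qed
      then show "h (age K x 0) = h (age K \<omega> 0)" by simp
    qed
  qed
  ultimately show ?thesis unfolding finitary_def by blast
qed

lemma funpow_left_shift: "(left_shift ^^ n) \<omega> = (\<lambda>i. \<omega> (i + int n))"
  by (induction n) (auto simp: left_shift_def add_ac)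

text \<open>Positivity rules out the zero sequence, and the entry of index \<open>n + 1\<close> is
  the value at time \<open>n\<close>, so the denominator runs over the times below
  \<open>n\<close>.\<close>

lemma extravagance_ramp_age:
  assumes "0 < t"
  shows "extravagance (\<lambda>\<omega>. ramp t (age K \<omega> 0)) left_shift \<omega> =
    limsup (\<lambda>n. ereal (ramp t (age K \<omega> (int n)) / (\<Sum>k<n. ramp t (age K \<omega> (int k)))))"
proof -
  have "age K ((left_shift ^^ n) \<omega>) 0 = age K \<omega> (int n)" for n
    by (simp add: funpow_left_shift age_def add.commute)
  moreover have "\<not> (\<forall>n\<ge>1. ramp t (age K \<omega> (int (n - 1))) = 0)"
    using ramp_pos[OF assms] less_irrefl by (metis order_refl)
  ultimately show ?thesis
    unfolding extravagance_def seq_extravagance_def by (auto simp: sum.atLeast1_atMost_eq)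
qed

lemma le_limsupI:
  assumes "\<And>n. \<exists>m\<ge>n. c \<le> f m"
  shows "c \<le> limsup (f :: nat \<Rightarrow> ereal)"
  unfolding limsup_INF_SUP
proof (rule INF_greatest)
  fix n
  obtain m where "n \<le> m" "c \<le> f m" using assms by blast
  then show "c \<le> (SUP m\<in>{n..}. f m)" by (intro SUP_upper2[of m]) auto
qed

text \<open>The upper bound needs one reset only. The lower bound comes from infinitely many records
  for each sufficiently large \<open>e\<close>; intersecting over these countably many
  \<open>e\<close> and letting \<open>e\<close> grow yields \<open>t\<close>.\<close>

lemma AE_extravagance_ramp_age:
  assumes t: "0 < t" and K: "0 < K" "1 < (1 + t) * (1 - (1 / 2) ^ K)"
  shows "AE \<omega> in iid_measure. extravagance (\<lambda>\<omega>. ramp t (age K \<omega> 0)) left_shift \<omega> = ereal t"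
proof -
  define q :: real where "q = 1 - (1 / 2) ^ K"
  have q: "0 < q" "q < 1" using K by (auto simp: q_def power_less_one_iff)
  define C where "C = (1 + t) * q / ((1 + t) * q - 1)"
  have C: "0 < C" using K t q by (auto simp: C_def q_def[symmetric])
  interpret bernoulli_sequence iid_measure "\<lambda>n \<omega>. \<omega> (int n) \<le> K" q
    unfolding q_def by (rule bernoulli_sequence_iid_measure) (simp add: inj_def)
  \<comment> \<open>The index starts at 1 since the upper bound asks for a reset at a time of at
    least 1.\<close>
  interpret shifted: bernoulli_sequence iid_measure "\<lambda>n \<omega>. \<omega> (int (1 + n)) \<le> K" q
    unfolding q_def by (rule bernoulli_sequence_iid_measure) (simp add: inj_def)
  let ?ratio = "\<lambda>\<omega> n. ramp t (age K \<omega> (int n)) / (\<Sum>k<n. ramp t (age K \<omega> (int k)))"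
  let ?bound = "\<lambda>e. t / (1 + (C + 1) / (1 + t) ^ e)"
  have upper: "AE \<omega> in iid_measure. limsup (\<lambda>n. ereal (?ratio \<omega> n)) \<le> ereal t"
    using AE_iid_ex_gt_neg[OF K(1)] shifted.AE_ex_not[OF q(2)]
  proof eventually_elim
    case (elim \<omega>)
    then obtain n where "\<not> \<omega> (int (1 + n)) \<le> K" by blast
    then show ?case
      using age_Suc[OF elim(1)] t
      by (intro limsup_ramp_ratio_le[where b = "\<lambda>n. \<omega> (int n) \<le> K" and s = "1 + n"]) auto
  qed
  have "AE \<omega> in iid_measure. ereal (?bound e) \<le> limsup (\<lambda>n. ereal (?ratio \<omega> n))"
    if e: "C < (1 + t) ^ Suc e" for e
  proof -
    from AE_infinite_record_windows[of "1 + t" e] q K t e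
    obtain u r m :: "nat \<Rightarrow> nat" where u: "\<And>k. k < u k"
      and r: "\<And>k. real (u k) * (1 + t) ^ (2 * u k) \<le> (1 + t) ^ r k"
      and rec: "AE \<omega> in iid_measure. infinite {k. record_window (1 + t) C (m k) (r k) e (\<lambda>i. \<omega> (int (u k + i)) \<le> K)}"
      unfolding C_def q_def by auto
    show ?thesis
      using rec AE_iid_ex_gt_neg[OF K(1)]
    proof eventually_elim
      case (elim \<omega>)
      show ?case
      proof (rule le_limsupI)
        fix n
        \<comment> \<open>Since \<open>k < u k\<close>, exceeding \<open>n\<close> places the record
          late enough, and exceeding the age at 0 meets the hypothesis on
          \<open>a 0\<close>.\<close>
        obtain k where k: "max n (age K \<omega> 0) < k"
          "record_window (1 + t) C (m k) (r k) e (\<lambda>i. \<omega> (int (u k + i)) \<le> K)"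
          using elim(1) unfolding infinite_nat_iff_unbounded by blast
        obtain n' where "u k \<le> n'" "?bound e \<le> ?ratio \<omega> n'"
          by (rule ramp_ratio_ge_if_record_window[where t = t and C = C and a = "\<lambda>n. age K \<omega> (int n)"
              and b = "\<lambda>n. \<omega> (int n) \<le> K" and u = "u k" and r = "r k" and m = "m k" and e = e])
             (use t C age_Suc[OF elim(2)] u[of k] k r in auto)
        then show "\<exists>n'\<ge>n. ereal (?bound e) \<le> ereal (?ratio \<omega> n')"
          using k(1) u[of k] by (intro exI[of _ n']) auto
      qed
    qed
  qed
  then have "AE \<omega> in iid_measure. \<forall>e. C < (1 + t) ^ Suc e \<longrightarrow>
      ereal (?bound e) \<le> limsup (\<lambda>n. ereal (?ratio \<omega> n))"
    by (subst AE_all_countable) simp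
  then show ?thesis
    using upper
  proof eventually_elim
    case (elim \<omega>)
    have "(\<lambda>e. ?bound e) \<longlonglongrightarrow> t / (1 + 0)"
      using t by (intro tendsto_intros LIMSEQ_divide_realpow_zero) auto
    then have "(\<lambda>e. ereal (?bound e)) \<longlonglongrightarrow> ereal t" by simp
    moreover have "\<forall>\<^sub>F e in sequentially. C < (1 + t) ^ Suc e"
      using t by real_asymp
    then have "\<forall>\<^sub>F e in sequentially. ereal (?bound e) \<le> limsup (\<lambda>n. ereal (?ratio \<omega> n))"
      by eventually_elim (use elim(1) in blast)
    ultimately have "ereal t \<le> limsup (\<lambda>n. ereal (?ratio \<omega> n))"
      by (rule tendsto_upperbound) simp
    then show ?case
      using elim(2) by (simp add: extravagance_ramp_age[OF t])
  qed
qed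

theorem mainTheorem2:
  shows "\<exists>(p :: nat \<Rightarrow> nat \<Rightarrow> real) (\<rho> :: nat \<Rightarrow> real) (m :: (int \<Rightarrow> nat) measure).
    markov_shift p \<rho> m \<and>
    (\<forall>t::real. 0 \<le> t \<longrightarrow>
      (\<exists>g :: (int \<Rightarrow> nat) \<Rightarrow> real.
        finitary m g \<and> (\<forall>\<omega>\<in>space m. 0 \<le> g \<omega>) \<and>
        (AE \<omega> in m. extravagance g left_shift \<omega> = ereal t)))"
proof -
  have "\<exists>g. finitary iid_measure g \<and> (\<forall>\<omega>\<in>space iid_measure. 0 \<le> g \<omega>) \<and>
      (AE \<omega> in iid_measure. extravagance g left_shift \<omega> = ereal t)" if "0 \<le> t" for t
  proof (cases "t = 0")
    case True
    \<comment> \<open>For \<open>t = 0\<close> the zero function serves, with extravagance 0 by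
      convention.\<close>
    have "finitary iid_measure (\<lambda>_. 0)"
      using finitary_age[of 1 "\<lambda>_. 0"] by simp
    then show ?thesis
      using True by (intro exI[of _ "\<lambda>_. 0"]) (auto simp: extravagance_def seq_extravagance_def zero_ereal_def)
  next
    case False
    then have t: "0 < t" using \<open>0 \<le> t\<close> by simp
    \<comment> \<open>The shift is the same for all \<open>t\<close>; only the threshold
      \<open>K\<close> depends on \<open>t\<close>, and it must grow as \<open>t\<close> approaches
      0.\<close>
    have "(\<lambda>K. (1 + t) * (1 - (1 / 2) ^ K)) \<longlonglongrightarrow> (1 + t) * (1 - 0)"
      by (intro tendsto_intros LIMSEQ_realpow_zero) auto
    then have "\<forall>\<^sub>F K in sequentially. 1 < (1 + t) * (1 - (1 / 2) ^ K)"
      using t by (intro order_tendstoD) auto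
    moreover have "\<forall>\<^sub>F K :: nat in sequentially. 0 < K"
      by (rule eventually_gt_at_top)
    ultimately have "\<forall>\<^sub>F K in sequentially. 0 < K \<and> 1 < (1 + t) * (1 - (1 / 2) ^ K)"
      by eventually_elim simp
    then obtain K where K: "0 < K" "1 < (1 + t) * (1 - (1 / 2) ^ K)"
      by (auto simp: eventually_sequentially)
    show ?thesis
      using finitary_age[OF K(1), of "ramp t"] AE_extravagance_ramp_age[OF t K] ramp_pos[OF t]
      by (intro exI[of _ "\<lambda>\<omega>. ramp t (age K \<omega> 0)"]) (auto intro: less_imp_le)
  qed
  then show ?thesis
    using markov_shift_iid_measure by blast
qed

end
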